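(* Let $a,b$ be real numbers and let $Q$ be given by $$Q(s,t)=\int_0^{s\wedge t} u^a\left[(t-u)^b+(s-u)^b\right]du,\qquad s,t\ge 0.$$ Then $Q$ is (a finite-valued) positive-definite function on $[0,\infty)\times[0,\infty)$ if and only if $a$ and $b$ satisfy $$a>-1,\qquad -1<b\le 1,\qquad |b|\le 1+a.$$
   Context: Here $s\wedge t=\min(s,t)$. A symmetric function $Q:[0,\infty)^2\to\mathbb{R}$ is called positive-definite if $\sum_{i,j=1}^n c_ic_jQ(t_i,t_j)\ge 0$ for all $n\ge 1$, $t_1,\dots,t_n\ge 0$ and $c_1,\dots,c_n\in\mathbb{R}$, i.e. if $Q$ is the covariance function of some (centered Gaussian) stochastic process indexed by $[0,\infty)$. If $a\le -1$ or $b\le -1$, then the integral defining $Q$ is not finite (e.g. for $s=t>0$), and $Q$ is regarded as not positive-definite. *)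

theory Defs
  imports "HOL-Analysis.Analysis"
begin

text \<open>
  The integral is taken over the open interval, so that \<open>powr\<close> is only ever applied to positive
  bases there (in HOL, \<open>0 powr x = 0\<close> for every \<open>x\<close>, including \<open>x = 0\<close>).
\<close>

definition Q_integrand :: "real \<Rightarrow> real \<Rightarrow> real \<Rightarrow> real \<Rightarrow> real \<Rightarrow> real" where
  "Q_integrand a b s t u = u powr a * ((t - u) powr b + (s - u) powr b)"

definition Q :: "real \<Rightarrow> real \<Rightarrow> real \<Rightarrow> real \<Rightarrow> real" where
  "Q a b s t = (LBINT u:{0<..<min s t}. Q_integrand a b s t u)"

text \<open>
  The Lebesgue integral of a non-integrable function is \<open>0\<close> in HOL, so finiteness of the
  integral has to be stated separately. As the integrand is measurable and nonnegative,
  integrability says exactly that the integral is finite.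
\<close>

definition Q_finite_valued :: "real \<Rightarrow> real \<Rightarrow> bool" where
  "Q_finite_valued a b \<longleftrightarrow>
     (\<forall>s\<ge>0. \<forall>t\<ge>0. set_integrable lborel {0<..<min s t} (Q_integrand a b s t))"

definition positive_definite_on :: "'a set \<Rightarrow> ('a \<Rightarrow> 'a \<Rightarrow> real) \<Rightarrow> bool" where
  "positive_definite_on T K \<longleftrightarrow>
     (\<forall>x\<in>T. \<forall>y\<in>T. K x y = K y x) \<and>
     (\<forall>(n::nat) (t :: nat \<Rightarrow> 'a) (c :: nat \<Rightarrow> real).
        n \<ge> 1 \<longrightarrow> (\<forall>i\<in>{1..n}. t i \<in> T) \<longrightarrow>
        (\<Sum>i=1..n. \<Sum>j=1..n. c i * c j * K (t i) (t j)) \<ge> 0)"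

end

(*
  Write m = min s t, M = max s t and expand (1 - z)^b = sum_k d_k z^k. By dominated convergence
  Q(s,t) is the limit of the partial sums of

    d_k / (a+k+1) * (m^(a+k+1) M^(b-k) + m^(a+b+1)).

  For b <= 0 all d_k are nonnegative, and m^p M^q = (st)^q m^(p-q) is positive-definite for p >= q.
  For 0 < b <= 1 only d_0 is positive. With beta = b - k and r = a + 2k + 1 - b >= 0, the kernel
  int_0^m r w^(r-1) (s^beta - w^beta) (t^beta - w^beta) dw is positive-definite, and
  the k-th term is d_k / beta >= 0 times it plus 2 d_k / (a+b+1) * m^(a+b+1). The latter add up to
  2 / (a+b+1) * (d_0 + ... + d_(K-1)) * m^(a+b+1), whose coefficient is nonnegative.

  Conversely, Cauchy-Schwarz for the points s and 1, as s -> 0, forces a+b+1 >= 0 and a+1-b >= 0.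
  If X has covariance Q, then E (X_t - X_s)^2 = 2 int_s^t u^a (t-u)^b du is of order (t-s)^(b+1)
  near 1; comparing steps h and 2h through the parallelogram law gives 2^(b+1) <= 4.
*)

theory Submission
  imports Defs
begin


section \<open>Integrability of powers and of the beta integrand\<close>

lemma powr_integral_from_0:
  fixes p x :: real
  assumes "p > -1" "x \<ge> 0"
  shows "set_integrable lborel {0<..<x} (\<lambda>u. u powr p)"
    and "(LBINT u:{0<..<x}. u powr p) = x powr (p + 1) / (p + 1)"
proof -
  have hi: "((\<lambda>u. u powr p) has_integral (x powr (p+1)/(p+1))) {0<..<x}"
    using has_integral_powr_from_0[OF assms] by (simp add: has_integral_Icc_iff_Ioo)
  \<comment> \<open>For a nonnegative function gauge integrability gives absolute integrability for
    \<open>lebesgue\<close>; Borel measurability then brings it down to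
    \<open>lborel\<close>.\<close>
  have "(\<lambda>u::real. u powr p) absolutely_integrable_on {0<..<x}"
    using hi by (intro nonnegative_absolutely_integrable_1) (auto simp: integrable_on_def)
  then have "integrable lebesgue (\<lambda>u. indicator {0<..<x} u *\<^sub>R (u powr p))"
    by (simp add: set_integrable_def)
  then show *: "set_integrable lborel {0<..<x} (\<lambda>u. u powr p)"
    unfolding set_integrable_def by (subst (asm) integrable_completion) auto
  show "(LBINT u:{0<..<x}. u powr p) = x powr (p + 1) / (p + 1)"
    using set_borel_integral_eq_integral(2)[OF *] hi by (simp add: integral_unique)
qed

lemma reflect_set_integrable:
  fixes f :: "real \<Rightarrow> real"
  shows "set_integrable lborel {0<..<t} (\<lambda>u. f (t - u)) \<longleftrightarrow> set_integrable lborel {0<..<t} f"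
proof -
  have "set_integrable lborel {0<..<t} f \<longleftrightarrow>
     integrable lborel (\<lambda>u. indicator {0<..<t} (t + -1 * u) *\<^sub>R f (t + -1 * u))"
    unfolding set_integrable_def by (subst lborel_integrable_real_affine_iff) auto
  also have "(\<lambda>u. indicator {0<..<t} (t + -1 * u) *\<^sub>R f (t + -1 * u)) = 
     (\<lambda>u. indicator {0<..<t} u *\<^sub>R f (t - u))"
    by (auto simp: indicator_def)
  finally show ?thesis unfolding set_integrable_def by simp
qed

text \<open>Each factor is singular at one end only: \<open>(t - u) powr b\<close> is bounded for
  \<open>u \<le> t/2\<close> and \<open>u powr a\<close> for \<open>u \<ge> t/2\<close>, so a
  combination of the two single powers dominates the product on the whole of
  \<open>{0<..<t}\<close>.\<close>

lemma beta_set_integrable: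
  fixes a b t x :: real
  assumes "a > -1" "b > -1" "x \<le> t"
  shows "set_integrable lborel {0<..<x} (\<lambda>u. u powr a * (t - u) powr b)"
proof (cases "t > 0")
  case True
  \<comment> \<open>A power is monotone on the interval from \<open>t/2\<close> to \<open>t\<close>,
    so the sum of its two endpoint values bounds it whatever the sign of \<open>c\<close>.\<close>
  define C where "C c = (t/2) powr c + t powr c" for c
  have C: "y powr c \<le> C c" if "t/2 \<le> y" "y \<le> t" for y c
  proof (cases "c \<ge> 0")
    case True
    then have "y powr c \<le> t powr c" using that \<open>t > 0\<close> by (intro powr_mono2) auto
    then show ?thesis by (simp add: C_def add_increasing)
  next
    case False
    then have "y powr c \<le> (t/2) powr c" using that \<open>t > 0\<close> by (intro powr_mono2') auto
    then show ?thesis by (simp add: C_def add_increasing2)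
  qed
  have C0: "C c \<ge> 0" for c by (simp add: C_def)
  have 1: "set_integrable lborel {0<..<t} (\<lambda>u. u powr a)" "set_integrable lborel {0<..<t} (\<lambda>u. (t-u) powr b)"
    using powr_integral_from_0(1)[of _ t] assms True by (auto simp: reflect_set_integrable[of t "\<lambda>u. u powr b"])
  have 2: "set_integrable lborel {0<..<t} (\<lambda>u. C b * u powr a + C a * (t-u) powr b)"
    by (intro set_integral_add set_integrable_mult_right 1 impI)
  have "set_integrable lborel {0<..<t} (\<lambda>u. u powr a * (t - u) powr b)"
  proof (rule set_integrable_bound[OF 2])
    show "set_borel_measurable lborel {0<..<t} (\<lambda>u. u powr a * (t - u) powr b)"
      unfolding set_borel_measurable_def by measurable
    have "u powr a * (t - u) powr b \<le> C b * u powr a + C a * (t-u) powr b" if "0 < u" "u < t" for u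
    proof (cases "u \<le> t/2")
      case True
      then have "u powr a * (t - u) powr b \<le> u powr a * C b"
        using that by (intro mult_left_mono C) auto
      then show ?thesis using C0[of a] by (simp add: mult.commute add_increasing2)
    next
      case False
      then have "u powr a * (t - u) powr b \<le> C a * (t-u) powr b"
        using that by (intro mult_right_mono C) auto
      then show ?thesis using C0[of b] by (simp add: add_increasing)
    qed
    then show "AE u in lborel. u \<in> {0<..<t} \<longrightarrow> norm (u powr a * (t - u) powr b) \<le> norm (C b * u powr a + C a * (t-u) powr b)"
      using C0 by (auto simp: abs_mult)
  qed
  then show ?thesis by (rule set_integrable_subset) (use assms in auto)
next
  case False
  then show ?thesis using assms by (simp add: set_integrable_def)
qed

text \<open>If \<open>a \<le> -1\<close>, then \<open>u powr a\<close> dominates \<open>1/u\<close>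
  on \<open>{0<..<1}\<close>, and the integrals of \<open>1/u\<close> over \<open>{e<..<d}\<close>
  grow without bound as \<open>e\<close> tends to 0.\<close>

lemma powr_integrable_imp_gt:
  fixes a c :: real
  assumes "c > 0" and int: "set_integrable lborel {0<..<c} (\<lambda>u. u powr a)"
  shows "a > -1"
proof (rule ccontr)
  assume na: "\<not> a > -1"
  define d where "d = min c 1"
  have d: "0 < d" "d \<le> 1" "d \<le> c" using assms by (auto simp: d_def)
  define I where "I = (LBINT u:{0<..<c}. u powr a)"
  have le: "ln d - ln e \<le> I" if e: "0 < e" "e < d" for e
  proof -
    have *: "((\<lambda>u. inverse u) has_integral (ln d - ln e)) {e..d}"
      using e by (intro fundamental_theorem_of_calculus)
        (auto intro!: derivative_eq_intros simp: has_real_derivative_iff_has_vector_derivative[symmetric] field_simps)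
    have **: "((\<lambda>u. u powr a) has_integral I) {0<..<c}"
      using set_borel_integral_eq_integral[OF int] by (simp add: I_def has_integral_integral)
    have io: "(\<lambda>u. u powr a) integrable_on {e<..<d}"
    proof (rule set_borel_integral_eq_integral)
      show "set_integrable lborel {e<..<d} (\<lambda>u. u powr a)"
        by (rule set_integrable_subset[OF int]) (use e d in auto)
    qed
    have hi: "((\<lambda>u. inverse u) has_integral (ln d - ln e)) {e<..<d}"
      using * by (simp add: has_integral_Icc_iff_Ioo)
    have inv_le: "inverse u \<le> u powr a" if "u \<in> {e<..<d}" for u
    proof -
      have u: "0 < u" "u \<le> 1" using that e d by auto
      have "u powr (-1) \<le> u powr a" using na u by (intro powr_mono') auto
      then show ?thesis using u by (simp add: powr_minus)
    qed
    have "ln d - ln e \<le> integral {e<..<d} (\<lambda>u. u powr a)"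
      using hi integrable_integral[OF io] inv_le by (rule has_integral_le)
    also have "\<dots> \<le> integral {0<..<c} (\<lambda>u. u powr a)"
    proof (rule integral_subset_le[OF _ io])
      show "{e<..<d} \<subseteq> {0<..<c}" using e d by auto
      show "(\<lambda>u. u powr a) integrable_on {0<..<c}" using ** by (auto simp: integrable_on_def)
    qed simp
    also have "\<dots> = I" using ** by (rule integral_unique)
    finally show ?thesis .
  qed
  \<comment> \<open>Chosen so that \<open>ln d - ln e\<close> equals
    \<open>\<bar>I\<bar> + 1\<close>, which exceeds \<open>I\<close>.\<close>
  define e where "e = d * exp (- (\<bar>I\<bar> + 1))"
  have "e > 0" using d by (simp add: e_def)
  moreover have "e < d * 1" unfolding e_def using d by (intro mult_strict_left_mono) auto
  ultimately have "ln d - ln e \<le> I" by (intro le) auto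
  then show False using d by (simp add: e_def ln_mult)
qed


section \<open>Closure properties of positive-definite kernels\<close>

lemma positive_definite_onI:
  assumes "\<And>x y. x \<in> T \<Longrightarrow> y \<in> T \<Longrightarrow> K x y = K y x"
    and "\<And>(n::nat) t (c :: nat \<Rightarrow> real). \<forall>i\<in>{1..n}. t i \<in> T \<Longrightarrow>
           (\<Sum>i=1..n. \<Sum>j=1..n. c i * c j * K (t i) (t j)) \<ge> 0"
  shows "positive_definite_on T K"
  using assms unfolding positive_definite_on_def by blast

lemma positive_definite_on_sym:
  assumes "positive_definite_on T K" "x \<in> T" "y \<in> T"
  shows "K x y = K y x"
  using assms unfolding positive_definite_on_def by blast

lemma positive_definite_on_nonneg:
  fixes n :: nat
  assumes "positive_definite_on T K" "\<forall>i\<in>{1..n}. t i \<in> T"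
  shows "(\<Sum>i=1..n. \<Sum>j=1..n. c i * c j * K (t i) (t j)) \<ge> 0"
proof (cases "n \<ge> 1")
  case True
  then show ?thesis using assms unfolding positive_definite_on_def by blast
qed simp

lemma positive_definite_on_cong:
  assumes "positive_definite_on T K" "\<And>x y. x \<in> T \<Longrightarrow> y \<in> T \<Longrightarrow> K' x y = K x y"
  shows "positive_definite_on T K'"
proof (rule positive_definite_onI)
  fix n :: nat and t and c :: "nat \<Rightarrow> real"
  assume t: "\<forall>i\<in>{1..n}. t i \<in> T"
  have "(\<Sum>i=1..n. \<Sum>j=1..n. c i * c j * K' (t i) (t j)) = (\<Sum>i=1..n. \<Sum>j=1..n. c i * c j * K (t i) (t j))"
    by (intro sum.cong refl) (use assms(2) t in auto)
  then show "(\<Sum>i=1..n. \<Sum>j=1..n. c i * c j * K' (t i) (t j)) \<ge> 0"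
    using positive_definite_on_nonneg[OF assms(1) t] by simp
qed (use assms(2) positive_definite_on_sym[OF assms(1)] in auto)

lemma positive_definite_on_add:
  assumes "positive_definite_on T K" "positive_definite_on T L"
  shows "positive_definite_on T (\<lambda>x y. K x y + L x y)"
proof (rule positive_definite_onI)
  fix n :: nat and t and c :: "nat \<Rightarrow> real"
  assume t: "\<forall>i\<in>{1..n}. t i \<in> T"
  show "(\<Sum>i=1..n. \<Sum>j=1..n. c i * c j * (K (t i) (t j) + L (t i) (t j))) \<ge> 0"
    unfolding distrib_left sum.distrib by (intro add_nonneg_nonneg positive_definite_on_nonneg[OF _ t] assms)
qed (use assms positive_definite_on_sym in metis)

lemma positive_definite_on_scale:
  assumes "positive_definite_on T K" "k \<ge> 0"
  shows "positive_definite_on T (\<lambda>x y. k * K x y)"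
proof (rule positive_definite_onI)
  fix n :: nat and t and c :: "nat \<Rightarrow> real"
  assume t: "\<forall>i\<in>{1..n}. t i \<in> T"
  have "(\<Sum>i=1..n. \<Sum>j=1..n. c i * c j * (k * K (t i) (t j))) =
    k * (\<Sum>i=1..n. \<Sum>j=1..n. c i * c j * K (t i) (t j))"
    by (simp add: sum_distrib_left mult_ac)
  then show "(\<Sum>i=1..n. \<Sum>j=1..n. c i * c j * (k * K (t i) (t j))) \<ge> 0"
    using positive_definite_on_nonneg[OF assms(1) t] assms(2) by simp
qed (use positive_definite_on_sym[OF assms(1)] in auto)

lemma positive_definite_on_rank_one:
  "positive_definite_on T (\<lambda>x y. f x * f y)"
proof (rule positive_definite_onI)
  fix n :: nat and t and c :: "nat \<Rightarrow> real"
  have "(\<Sum>i=1..n. \<Sum>j=1..n. c i * c j * (f (t i) * f (t j))) = (\<Sum>i=1..n. c i * f (t i))\<^sup>2"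
    by (simp add: power2_eq_square sum_product mult_ac)
  then show "(\<Sum>i=1..n. \<Sum>j=1..n. c i * c j * (f (t i) * f (t j))) \<ge> 0" by simp
qed simp

lemma positive_definite_on_sum:
  assumes "\<And>k. k \<in> A \<Longrightarrow> positive_definite_on T (K k)"
  shows "positive_definite_on T (\<lambda>x y. \<Sum>k\<in>A. K k x y)"
  using assms
proof (induction A rule: infinite_finite_induct)
  case (insert a A)
  then show ?case by (simp add: positive_definite_on_add)
qed (simp_all add: positive_definite_on_def)

text \<open>The weights are absorbed into the coefficients: \<open>c i\<close> becomes
  \<open>c i * f (t i)\<close>.\<close>

lemma positive_definite_on_weight:
  assumes "positive_definite_on T K"
  shows "positive_definite_on T (\<lambda>x y. f x * f y * K x y)"
proof (rule positive_definite_onI)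
  fix n :: nat and t and c :: "nat \<Rightarrow> real"
  assume t: "\<forall>i\<in>{1..n}. t i \<in> T"
  show "(\<Sum>i=1..n. \<Sum>j=1..n. c i * c j * (f (t i) * f (t j) * K (t i) (t j))) \<ge> 0"
    using positive_definite_on_nonneg[OF assms t, of "\<lambda>i. c i * f (t i)"]
    by (simp add: mult_ac)
qed (use positive_definite_on_sym[OF assms(1)] in auto)

lemma positive_definite_on_limit:
  assumes "\<And>k. positive_definite_on T (K k)"
    and lim: "\<And>x y. x \<in> T \<Longrightarrow> y \<in> T \<Longrightarrow> (\<lambda>k. K k x y) \<longlonglongrightarrow> L x y"
  shows "positive_definite_on T L"
proof (rule positive_definite_onI)
  fix x y assume xy: "x \<in> T" "y \<in> T"
  have "(\<lambda>k. K k x y) = (\<lambda>k. K k y x)" using positive_definite_on_sym[OF assms(1)] xy by auto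
  then show "L x y = L y x" using lim[OF xy] lim[OF xy(2,1)] LIMSEQ_unique by metis
next
  fix n :: nat and t and c :: "nat \<Rightarrow> real"
  assume t: "\<forall>i\<in>{1..n}. t i \<in> T"
  have "(\<lambda>k. \<Sum>i=1..n. \<Sum>j=1..n. c i * c j * K k (t i) (t j)) \<longlonglongrightarrow>
        (\<Sum>i=1..n. \<Sum>j=1..n. c i * c j * L (t i) (t j))"
    using t by (intro tendsto_intros lim) auto
  then show "(\<Sum>i=1..n. \<Sum>j=1..n. c i * c j * L (t i) (t j)) \<ge> 0"
    by (rule LIMSEQ_le_const) (use positive_definite_on_nonneg[OF assms(1) t] in auto)
qed

text \<open>The quadratic form is the integral of \<open>g\<close> times the square of a linear
  combination of the \<open>\<phi> (t i)\<close>.\<close>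

lemma positive_definite_on_integral:
  assumes "\<And>x y. x \<in> T \<Longrightarrow> y \<in> T \<Longrightarrow> integrable M (\<lambda>w. g w * (\<phi> x w * \<phi> y w))"
    and "\<And>w. g w \<ge> (0::real)"
  shows "positive_definite_on T (\<lambda>x y. \<integral>w. g w * (\<phi> x w * \<phi> y w) \<partial>M)"
proof (rule positive_definite_onI)
  fix n :: nat and t and c :: "nat \<Rightarrow> real"
  assume t: "\<forall>i\<in>{1..n}. t i \<in> T"
  have "(\<Sum>i=1..n. \<Sum>j=1..n. c i * c j * (\<integral>w. g w * (\<phi> (t i) w * \<phi> (t j) w) \<partial>M)) =
    (\<integral>w. (\<Sum>i=1..n. \<Sum>j=1..n. c i * c j * (g w * (\<phi> (t i) w * \<phi> (t j) w))) \<partial>M)"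
    using assms(1) t by (subst Bochner_Integration.integral_sum; (intro Bochner_Integration.integrable_sum integrable_mult_right)?; simp)+
  also have "\<dots> = (\<integral>w. g w * (\<Sum>i=1..n. c i * \<phi> (t i) w)\<^sup>2 \<partial>M)"
    by (intro Bochner_Integration.integral_cong refl)
       (simp add: power2_eq_square sum_product sum_distrib_left mult_ac)
  also have "\<dots> \<ge> 0" using assms(2) by (intro integral_nonneg_AE) auto
  finally show "(\<Sum>i=1..n. \<Sum>j=1..n. c i * c j * (\<integral>w. g w * (\<phi> (t i) w * \<phi> (t j) w) \<partial>M)) \<ge> 0" .
qed (simp add: mult_ac)

section \<open>Positive-definite kernels in the minimum and maximum of the arguments\<close>

text \<open>This is the Brownian covariance, the inner product in L2 of the indicators of
  \<open>{0<..<s}\<close> and \<open>{0<..<t}\<close>.\<close>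

lemma positive_definite_on_min:
  "positive_definite_on {0..} (\<lambda>s t::real. min s t)"
proof -
  have eq: "1 * (indicator {0<..<s} w * indicator {0<..<t} w) = (indicator {0<..<min s t} w :: real)" for s t w :: real
    by (auto simp: indicator_def)
  have "positive_definite_on {0..} (\<lambda>s t::real. \<integral>w. 1 * (indicator {0<..<s} w * indicator {0<..<t} w) \<partial>lborel)"
    by (rule positive_definite_on_integral) (simp_all only: eq, auto)
  then show ?thesis
    by (rule positive_definite_on_cong) (simp only: eq, auto)
qed

text \<open>A time change: an increasing map commutes with \<open>min\<close>, so this is the
  \<open>min\<close> kernel at the points \<open>t i powr r\<close>.\<close>

lemma positive_definite_on_min_powr:
  assumes "r \<ge> (0::real)"
  shows "positive_definite_on {0..} (\<lambda>s t. min s t powr r)"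
proof (rule positive_definite_onI)
  fix n :: nat and t c :: "nat \<Rightarrow> real"
  assume t: "\<forall>i\<in>{1..n}. t i \<in> {0..}"
  have eq: "min x y powr r = min (x powr r) (y powr r)" if "x \<ge> 0" "y \<ge> 0" for x y :: real
    using that assms powr_mono2[of r x y] powr_mono2[of r y x] by (auto simp: min_def)
  have "(\<Sum>i=1..n. \<Sum>j=1..n. c i * c j * min (t i) (t j) powr r) = 
    (\<Sum>i=1..n. \<Sum>j=1..n. c i * c j * min (t i powr r) (t j powr r))"
    by (intro sum.cong refl) (use t eq in auto)
  also have "\<dots> \<ge> 0"
    by (rule positive_definite_on_nonneg[OF positive_definite_on_min, of n "\<lambda>i. t i powr r"]) auto
  finally show "(\<Sum>i=1..n. \<Sum>j=1..n. c i * c j * min (t i) (t j) powr r) \<ge> 0" .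
qed (simp add: min.commute)

lemma positive_definite_on_min_max_powr:
  assumes "p \<ge> (q::real)"
  shows "positive_definite_on {0..} (\<lambda>s t. min s t powr p * max s t powr q)"
proof (rule positive_definite_on_cong)
  show "positive_definite_on {0..} (\<lambda>s t. s powr q * t powr q * min s t powr (p - q))"
    by (intro positive_definite_on_weight positive_definite_on_min_powr) (use assms in auto)
  fix s t :: real assume "s \<in> {0..}" "t \<in> {0..}"
  then show "min s t powr p * max s t powr q = s powr q * t powr q * min s t powr (p - q)"
    \<comment> \<open>If \<open>s\<close> or \<open>t\<close> is 0, both sides vanish because
      \<open>0 powr x = 0\<close> even for \<open>x \<le> 0\<close>.\<close>
    by (cases "s \<le> t"; cases "s = 0"; cases "t = 0") (auto simp: min_def max_def powr_diff)
qed


text \<open>For \<open>r > 0\<close> the kernel is the integral of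
  \<open>r * w powr (r - 1) * (s powr \<beta> - w powr \<beta>) * (t powr \<beta> - w powr \<beta>)\<close> over \<open>0 < w < min s t\<close>.\<close>

lemma positive_definite_on_difference_kernel:
  fixes r \<beta> :: real
  assumes "r \<ge> 0" "r + \<beta> > 0" "r + 2 * \<beta> > 0"
  shows "positive_definite_on {0..} (\<lambda>s t. \<beta> / (r + \<beta>) *
    (min s t powr (r + \<beta>) * max s t powr \<beta> - r / (r + 2 * \<beta>) * min s t powr (r + 2 * \<beta>)))"
proof (cases "r = 0")
  \<comment> \<open>The integral representation degenerates at \<open>r = 0\<close>; there
    \<open>\<beta> > 0\<close> and the kernel is just
    \<open>s powr \<beta> * t powr \<beta>\<close>.\<close>
  case True
  show ?thesis
    by (rule positive_definite_on_cong[OF positive_definite_on_rank_one[of _ "\<lambda>s. s powr \<beta>"]])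
       (use True assms in \<open>auto simp: min_def max_def\<close>)
next
  case False
  then have r: "r > 0" using assms by simp
  define \<phi> where "\<phi> s w = indicator {0<..<s} w * (s powr \<beta> - w powr \<beta>)" for s w :: real
  define g where "g w = r * w powr (r - 1)" for w :: real
  \<comment> \<open>Multiplied out, the integrand has the exponents \<open>r - 1\<close>,
    \<open>r + \<beta> - 1\<close> and \<open>r + 2 * \<beta> - 1\<close>; the sign conditions on
    \<open>r\<close>, \<open>r + \<beta>\<close> and \<open>r + 2 * \<beta>\<close> make each of
    them integrable at 0.\<close>
  have eq: "g w * (\<phi> s w * \<phi> t w) = indicator {0<..<min s t} w *\<^sub>R
      (r * (s powr \<beta> * t powr \<beta>) * w powr (r - 1) - r * (s powr \<beta> + t powr \<beta>) * w powr (r + \<beta> - 1)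
       + r * w powr (r + 2 * \<beta> - 1))" for s t w
  proof -
    have "w powr (r + \<beta> - 1) = w powr (r - 1) * w powr \<beta>"
         "w powr (r + 2 * \<beta> - 1) = w powr (r - 1) * (w powr \<beta> * w powr \<beta>)"
      by (simp_all add: powr_add [symmetric] algebra_simps)
    then show ?thesis by (auto simp: g_def \<phi>_def indicator_def algebra_simps)
  qed
  have int: "set_integrable lborel {0<..<min s t} (\<lambda>w. w powr (q - 1))"
            "(LBINT w:{0<..<min s t}. w powr (q - 1)) = min s t powr q / q"
    if "s \<ge> 0" "t \<ge> 0" "q > 0" for s t q :: real
    using powr_integral_from_0[of "q - 1" "min s t"] that by auto
  have "positive_definite_on {0..} (\<lambda>s t. \<integral>w. g w * (\<phi> s w * \<phi> t w) \<partial>lborel)"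
  proof (rule positive_definite_on_integral)
    fix s t :: real assume "s \<in> {0..}" "t \<in> {0..}"
    then show "integrable lborel (\<lambda>w. g w * (\<phi> s w * \<phi> t w))"
      unfolding eq set_integrable_def[symmetric] using assms r
      by (intro set_integral_add set_integral_diff set_integrable_mult_right int) auto
  qed (use r in \<open>auto simp: g_def\<close>)
  then show ?thesis
  proof (rule positive_definite_on_cong)
    fix s t :: real assume "s \<in> {0..}" "t \<in> {0..}"
    then have st: "s \<ge> 0" "t \<ge> 0" by auto
    note ints = int[OF st r] int[OF st assms(2)] int[OF st assms(3)]
    have "(\<integral>w. g w * (\<phi> s w * \<phi> t w) \<partial>lborel) =
      r * (s powr \<beta> * t powr \<beta>) * (min s t powr r / r)
      - r * (s powr \<beta> + t powr \<beta>) * (min s t powr (r + \<beta>) / (r + \<beta>))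
      + r * (min s t powr (r + 2 * \<beta>) / (r + 2 * \<beta>))"
      unfolding eq set_lebesgue_integral_def[symmetric]
      by (subst set_integral_add(2) set_integral_diff(2); (intro set_integral_add set_integral_diff set_integrable_mult_right ints impI)?)+
         (simp add: ints)
    also have "\<dots> = \<beta> / (r + \<beta>) *
      (min s t powr (r + \<beta>) * max s t powr \<beta> - r / (r + 2 * \<beta>) * min s t powr (r + 2 * \<beta>))"
    proof -
      define m where "m = min s t"
      define M where "M = max s t"
      \<comment> \<open>In terms of the powers of \<open>m\<close> and \<open>M\<close> the claim is
        a rational identity in \<open>r\<close> and \<open>\<beta>\<close>; the prefactor arises as
        \<open>1 - r / (r + \<beta>)\<close>.\<close>
      have pw: "m powr (r + \<beta>) = m powr r * m powr \<beta>" "m powr (r + 2 * \<beta>) = m powr r * m powr \<beta> * m powr \<beta>"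
        by (simp_all add: powr_add [symmetric] algebra_simps)
      have sym: "s powr \<beta> * t powr \<beta> = m powr \<beta> * M powr \<beta>" "s powr \<beta> + t powr \<beta> = m powr \<beta> + M powr \<beta>"
        by (auto simp: m_def M_def min_def max_def)
      show ?thesis using r assms
        unfolding sym m_def[symmetric] M_def[symmetric] pw
        by (simp add: divide_simps) (simp add: algebra_simps power2_eq_square)
    qed
    finally show "\<beta> / (r + \<beta>) * (min s t powr (r + \<beta>) * max s t powr \<beta> - r / (r + 2 * \<beta>) * min s t powr (r + 2 * \<beta>))
      = (\<integral>w. g w * (\<phi> s w * \<phi> t w) \<partial>lborel)" by simp
  qed
qed

section \<open>The binomial series and its partial sums\<close>

text \<open>The coefficient d_k of \<open>z ^ k\<close> in \<open>(1 - z) powr b\<close>, with the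
  alternating sign built in.\<close>

definition binom_coeff :: "real \<Rightarrow> nat \<Rightarrow> real" where
  "binom_coeff b k = (-1) ^ k * (b gchoose k)"

lemma binom_coeff_pochhammer: "binom_coeff b k = pochhammer (- b) k / fact k"
  by (simp add: binom_coeff_def gbinomial_pochhammer flip: power_mult_distrib mult.assoc)

lemma binom_coeff_nonneg: "b \<le> 0 \<Longrightarrow> binom_coeff b k \<ge> 0"
  unfolding binom_coeff_pochhammer by (auto intro!: divide_nonneg_nonneg pochhammer_nonneg simp: pochhammer_prod prod_nonneg)

text \<open>In the product (-b)(1-b)(2-b)... the first factor is nonpositive and all later ones are
  nonnegative.\<close>

lemma binom_coeff_nonpos:
  assumes "0 \<le> b" "b \<le> 1" "k \<ge> 1"
  shows "binom_coeff b k \<le> 0"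
proof -
  obtain j where k: "k = Suc j" using assms(3) by (cases k) auto
  have "pochhammer (1 - b) j \<ge> 0" using assms by (auto simp: pochhammer_prod intro!: prod_nonneg)
  then show ?thesis
    using assms by (simp add: binom_coeff_pochhammer k pochhammer_rec divide_nonpos_pos mult_nonneg_nonneg)
qed

text \<open>Partial sums of coefficients correspond to division of the series by
  \<open>1 - z\<close>, so they are coefficients of \<open>(1 - z) powr (b - 1)\<close>, whose
  exponent is nonpositive.\<close>

lemma sum_binom_coeff_nonneg:
  assumes "b \<le> 1"
  shows "(\<Sum>k<K. binom_coeff b k) \<ge> 0"
proof (cases K)
  case (Suc n)
  have "(\<Sum>k<K. binom_coeff b k) = (\<Sum>k\<le>n. (b gchoose k) * (-1) ^ k)"
    by (simp add: Suc lessThan_Suc_atMost binom_coeff_def mult.commute)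
  also have "\<dots> = binom_coeff (b - 1) n"
    by (simp add: gbinomial_sum_lower_neg binom_coeff_def)
  finally show ?thesis using binom_coeff_nonneg[of "b - 1" n] assms by simp
qed simp

lemma binom_coeff_sums:
  assumes "\<bar>z\<bar> < 1"
  shows "(\<lambda>k. binom_coeff b k * z ^ k) sums ((1 - z) powr b)"
  using gen_binomial_real[of "-z" b] assms
  by (simp add: binom_coeff_def power_minus[of z] mult_ac)

text \<open>Bounds uniform in \<open>K\<close>, for dominated convergence. For
  \<open>b \<le> 0\<close> the partial sums increase to \<open>(1 - z) powr b\<close>. For
  \<open>0 < b\<close> only the constant term 1 is positive, so the sum is at most 1, and at least
  its value at \<open>z = 1\<close>.\<close>

lemma binom_partial_sum_bounds:
  assumes "b \<le> 1" "0 \<le> z" "z < 1"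
  shows "0 \<le> (\<Sum>k<K. binom_coeff b k * z ^ k)"
    and "(\<Sum>k<K. binom_coeff b k * z ^ k) \<le> 1 + (1 - z) powr b"
proof -
  let ?T = "\<Sum>k<K. binom_coeff b k * z ^ k"
  have sums: "(\<lambda>k. binom_coeff b k * z ^ k) sums ((1 - z) powr b)"
    using assms by (intro binom_coeff_sums) auto
  have "0 \<le> ?T \<and> ?T \<le> 1 + (1 - z) powr b"
  proof (cases "b \<le> 0")
    case True
    then have nn: "binom_coeff b k * z ^ k \<ge> 0" for k using assms binom_coeff_nonneg by simp
    have "?T \<le> (1 - z) powr b"
      unfolding sums_unique[OF sums]
      using nn by (intro sum_le_suminf sums_summable[OF sums]) auto
    then show ?thesis using nn by (simp add: sum_nonneg)
  next
    case b: False
    have "(\<Sum>k<K. binom_coeff b k) \<le> ?T"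
    proof (rule sum_mono)
      fix k :: nat
      show "binom_coeff b k \<le> binom_coeff b k * z ^ k"
      proof (cases "k = 0")
        case False
        then have "binom_coeff b k * 1 \<le> binom_coeff b k * z ^ k"
          using binom_coeff_nonpos[of b k] b assms by (intro mult_left_mono_neg power_le_one) auto
        then show ?thesis by simp
      qed simp
    qed
    moreover have "?T \<le> (\<Sum>k<K. if k = 0 then 1 else 0)"
      using binom_coeff_nonpos[of b] b assms
      by (intro sum_mono) (auto simp: binom_coeff_def mult_nonpos_nonneg)
    moreover have "(\<Sum>k<K. if k = 0 then 1 else 0 :: real) \<le> 1" by (simp add: sum.delta)
    ultimately show ?thesis using sum_binom_coeff_nonneg[OF assms(1), of K]
      by (smt (verit) powr_ge_zero)
  qed
  then show "0 \<le> ?T" "?T \<le> 1 + (1 - z) powr b" by auto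
qed

section \<open>Series expansion of the integral defining Q\<close>

text \<open>The integrand is \<open>u powr a * t powr b * (1 - u / t) powr b\<close>; its binomial
  series is integrated term by term. The majorant remains integrable for \<open>x = t\<close>, where
  the integrand may be singular at the upper end.\<close>

lemma incomplete_beta_series:
  fixes a b x t :: real
  assumes a: "a > -1" and b: "-1 < b" "b \<le> 1" and x: "0 < x" "x \<le> t"
  shows "(\<lambda>K. \<Sum>k<K. binom_coeff b k / (a + k + 1) * (x powr (a + k + 1) * t powr (b - k)))
    \<longlonglongrightarrow> (LBINT u:{0<..<x}. u powr a * (t - u) powr b)"
proof -
  define f where "f K u = (\<Sum>k<K. binom_coeff b k * t powr (b - k) * u powr (a + k))" for K u
  have int: "set_integrable lborel {0<..<x} (\<lambda>u. u powr (a + real k))"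
       "(LBINT u:{0<..<x}. u powr (a + real k)) = x powr (a + k + 1) / (a + k + 1)" for k
    using powr_integral_from_0[of "a + k" x] a x by (simp_all add: add_ac)
  have f_eq: "f K u = u powr a * t powr b * (\<Sum>k<K. binom_coeff b k * (u / t) ^ k)" if "0 < u" for K u
    unfolding f_def sum_distrib_left
    by (intro sum.cong refl) (use that x in \<open>simp add: powr_add powr_diff powr_realpow power_divide\<close>)
  have factor: "u powr a * (t - u) powr b = u powr a * t powr b * (1 - u / t) powr b" if "0 < u" "u < x" for u
  proof -
    have "(t - u) powr b = (t * (1 - u / t)) powr b" using x by (simp add: algebra_simps)
    also have "\<dots> = t powr b * (1 - u / t) powr b" by (rule powr_mult)
    finally show ?thesis by simp
  qed
  have "(\<lambda>K. LBINT u:{0<..<x}. f K u) \<longlonglongrightarrow> (LBINT u:{0<..<x}. u powr a * (t - u) powr b)"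
    unfolding set_lebesgue_integral_def
  proof (rule integral_dominated_convergence)
    show "integrable lborel (\<lambda>u. indicator {0<..<x} u *\<^sub>R (t powr b * u powr a + u powr a * (t - u) powr b))"
      unfolding set_integrable_def[symmetric]
      using int[of 0] beta_set_integrable[OF a b(1) x(2)]
      by (intro set_integral_add set_integrable_mult_right) auto
    show "AE u in lborel. (\<lambda>K. indicator {0<..<x} u *\<^sub>R f K u) \<longlonglongrightarrow> indicator {0<..<x} u *\<^sub>R (u powr a * (t - u) powr b)"
    proof (rule AE_I2)
      fix u :: real
      show "(\<lambda>K. indicator {0<..<x} u *\<^sub>R f K u) \<longlonglongrightarrow> indicator {0<..<x} u *\<^sub>R (u powr a * (t - u) powr b)"
      proof (cases "u \<in> {0<..<x}")
        case True
        then have "(\<lambda>k. binom_coeff b k * (u / t) ^ k) sums ((1 - u / t) powr b)"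
          using x by (intro binom_coeff_sums) auto
        then have "(\<lambda>K. u powr a * t powr b * (\<Sum>k<K. binom_coeff b k * (u / t) ^ k)) \<longlonglongrightarrow> u powr a * t powr b * (1 - u / t) powr b"
          unfolding sums_def by (intro tendsto_intros)
        then show ?thesis using True f_eq factor by (simp add: mult.assoc)
      qed simp
    qed
    show "AE u in lborel. norm (indicator {0<..<x} u *\<^sub>R f K u)
            \<le> indicator {0<..<x} u *\<^sub>R (t powr b * u powr a + u powr a * (t - u) powr b)" for K
    proof (rule AE_I2)
      fix u :: real
      show "norm (indicator {0<..<x} u *\<^sub>R f K u)
            \<le> indicator {0<..<x} u *\<^sub>R (t powr b * u powr a + u powr a * (t - u) powr b)"
      proof (cases "u \<in> {0<..<x}")
        case True
        define T where "T = (\<Sum>k<K. binom_coeff b k * (u / t) ^ k)"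
        have T: "0 \<le> T" "T \<le> 1 + (1 - u / t) powr b"
          using binom_partial_sum_bounds[OF b(2), of "u / t" K] True x by (auto simp: T_def)
        have "u powr a * t powr b * T \<le> u powr a * t powr b * (1 + (1 - u / t) powr b)"
          using T by (intro mult_left_mono) auto
        then show ?thesis using True f_eq[of u K] factor[of u] T(1)
          by (simp add: T_def[symmetric] abs_mult algebra_simps)
      qed simp
    qed
  qed (unfold f_def, measurable)
  moreover have "(LBINT u:{0<..<x}. f K u) = (\<Sum>k<K. binom_coeff b k / (a + k + 1) * (x powr (a + k + 1) * t powr (b - k)))" for K
  proof -
    have "(LBINT u:{0<..<x}. f K u) = (\<Sum>k<K. LBINT u:{0<..<x}. binom_coeff b k * t powr (b - k) * u powr (a + k))"
      unfolding f_def set_lebesgue_integral_def scaleR_sum_right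
      by (rule Bochner_Integration.integral_sum)
         (unfold set_integrable_def[symmetric], intro set_integrable_mult_right int impI)
    then show ?thesis by (simp add: int mult_ac)
  qed
  ultimately show ?thesis by simp
qed


text \<open>For \<open>t = 1\<close> this is the classical incomplete beta function B(x; a+1,
  b+1).\<close>

definition incomplete_beta :: "real \<Rightarrow> real \<Rightarrow> real \<Rightarrow> real \<Rightarrow> real" where
  "incomplete_beta a b t x = (LBINT u:{0<..<x}. u powr a * (t - u) powr b)"

lemma set_integrable_Q_integrand:
  assumes "a > -1" "b > -1" "x \<le> min s t"
  shows "set_integrable lborel {0<..<x} (Q_integrand a b s t)"
  unfolding Q_integrand_def[abs_def] distrib_left
  by (intro set_integral_add beta_set_integrable) (use assms in auto)

lemma Q_eq_incomplete_beta:
  assumes "a > -1" "b > -1"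
  shows "Q a b s t = incomplete_beta a b t (min s t) + incomplete_beta a b s (min s t)"
  unfolding Q_def Q_integrand_def[abs_def] distrib_left incomplete_beta_def
  by (intro set_integral_add beta_set_integrable) (use assms in auto)

lemma Q_series:
  fixes a b s t :: real
  assumes a: "a > -1" and b: "-1 < b" "b \<le> 1" and st: "s \<ge> 0" "t \<ge> 0"
  shows "(\<lambda>K. \<Sum>k<K. binom_coeff b k / (a + k + 1) *
       (min s t powr (a + k + 1) * max s t powr (b - k) + min s t powr (a + b + 1))) \<longlonglongrightarrow> Q a b s t"
\<comment> \<open>At 0 the interval of integration is empty, and every summand is 0 because
  \<open>0 powr x = 0\<close>.\<close>
proof (cases "min s t = 0")
  case True
  then show ?thesis by (simp add: Q_def set_lebesgue_integral_def)
next
  case False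
  define m M where "m = min s t" and "M = max s t"
  have m: "0 < m" "m \<le> M" using False st by (auto simp: m_def M_def)
  have Q: "Q a b s t = incomplete_beta a b M m + incomplete_beta a b m m"
    using Q_eq_incomplete_beta[OF a b(1), of s t] by (auto simp: m_def M_def min_def max_def)
  \<comment> \<open>In the half of Q belonging to the smaller argument the upper limit equals that
    argument, so \<open>k\<close> cancels from the exponent.\<close>
  have eq: "m powr (a + real k + 1) * m powr (b - real k) = m powr (a + b + 1)" for k
    by (simp add: powr_add[symmetric] add_ac)
  show ?thesis
    using tendsto_add[OF incomplete_beta_series[OF a b m] incomplete_beta_series[OF a b m(1) order.refl]]
    unfolding Q incomplete_beta_def m_def[symmetric] M_def[symmetric] eq
    by (simp add: sum.distrib distrib_left)
qed

section \<open>Sufficiency of the conditions\<close>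

lemma Q_positive_definite:
  fixes a b :: real
  assumes a: "a > -1" and b: "-1 < b" "b \<le> 1" and ab: "\<bar>b\<bar> \<le> 1 + a"
  shows "positive_definite_on {0..} (Q a b)"
proof (rule positive_definite_on_limit)
  show "(\<lambda>K. \<Sum>k<K. binom_coeff b k / (a + k + 1) *
       (min s t powr (a + k + 1) * max s t powr (b - k) + min s t powr (a + b + 1))) \<longlonglongrightarrow> Q a b s t"
    if "s \<in> {0..}" "t \<in> {0..}" for s t
    using Q_series[OF a b] that by auto
  show "positive_definite_on {0..} (\<lambda>s t. \<Sum>k<K. binom_coeff b k / (a + k + 1) *
       (min s t powr (a + k + 1) * max s t powr (b - k) + min s t powr (a + b + 1)))" for K :: nat
  proof (cases "b \<le> 0")
    case True
    \<comment> \<open>Every summand is positive-definite by itself: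
      \<open>a + k + 1 \<ge> b - k\<close> since \<open>b \<le> 0 < a + 1\<close>, and
      \<open>a + b + 1 \<ge> 0\<close> is the bound on \<open>\<bar>b\<bar>\<close>.\<close>
    then show ?thesis using a b ab binom_coeff_nonneg[OF True]
      by (intro positive_definite_on_sum positive_definite_on_scale positive_definite_on_add
          positive_definite_on_min_max_powr positive_definite_on_min_powr divide_nonneg_nonneg) auto
  next
    case False
    define S where "S = a + b + 1"
    have S: "S > 0" using False ab a by (auto simp: S_def)
    \<comment> \<open>These solve \<open>r k + \<beta> k = a + k + 1\<close> and
      \<open>r k + 2 * \<beta> k = S\<close>, matching the difference kernel to the exponents of the
      k-th term; \<open>r k \<ge> 0\<close> comes from \<open>b \<le> 1 + a\<close>.\<close>
    define r \<beta> where "r k = a + 2 * real k + 1 - b" and "\<beta> k = b - real k" for k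
    have rb: "r k + \<beta> k = a + real k + 1" "r k + 2 * \<beta> k = S" "r k \<ge> 0" for k
      using ab by (auto simp: r_def \<beta>_def S_def)
    define G where "G k s t = \<beta> k / (r k + \<beta> k) *
      (min s t powr (r k + \<beta> k) * max s t powr \<beta> k - r k / (r k + 2 * \<beta> k) * min s t powr (r k + 2 * \<beta> k))" for k s t
    have G: "positive_definite_on {0..} (G k)" for k
      unfolding G_def using rb[of k] S a by (intro positive_definite_on_difference_kernel) auto
    have term_eq: "binom_coeff b k / (a + k + 1) *
       (min s t powr (a + k + 1) * max s t powr (b - k) + min s t powr (a + b + 1))
       = binom_coeff b k / \<beta> k * G k s t + 2 / S * binom_coeff b k * min s t powr S"
      if "s \<ge> 0" "t \<ge> 0" for s t k
    proof -
      define x where "x = min s t powr (a + k + 1) * max s t powr (b - k)"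
      define y where "y = min s t powr S"
      define p where "p = a + real k + 1"
      have p: "p > 0" using a by (simp add: p_def)
      have r: "r k = 2 * p - S" by (simp add: r_def p_def S_def)
      \<comment> \<open>Since \<open>1 + r k / S = 2 * p / S\<close>, the factor \<open>p\<close>
        cancels from the coefficient of \<open>y\<close> that is left over.\<close>
      have "binom_coeff b k / p * (x + y) = binom_coeff b k / p * (x - r k / S * y) + 2 / S * binom_coeff b k * y"
        using p S by (simp add: r field_simps)
      moreover have "binom_coeff b k / p * (x - r k / S * y) = binom_coeff b k / \<beta> k * G k s t"
      proof (cases "\<beta> k = 0")
        \<comment> \<open>only for \<open>b = k = 1\<close>; then \<open>r k = S\<close>, \<open>x = y\<close>, and the right-hand side is \<open>0\<close> because of \<open>x / 0 = 0\<close>\<close>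
        case True
        then have kb: "b = real k" by (simp add: \<beta>_def)
        have rS: "r k = S" and pS: "p = S" using kb by (auto simp: r_def S_def p_def)
        have "x = y"
          using that S unfolding x_def y_def kb by (auto simp: kb S_def min_def max_def)
        then show ?thesis using True rS S by simp
      next
        case False
        then show ?thesis unfolding G_def rb x_def y_def p_def \<beta>_def[symmetric] by simp
      qed
      ultimately show ?thesis unfolding x_def y_def p_def S_def by simp
    qed
    have coeff: "binom_coeff b k / \<beta> k \<ge> 0" for k
    proof (cases "k = 0")
      case True
      then show ?thesis using False by (simp add: \<beta>_def binom_coeff_def)
    next
      case k: False
      \<comment> \<open>Here \<open>\<beta> k = b - k \<le> 0\<close>, so numerator and denominator
        are both nonpositive; for \<open>b = k = 1\<close> the quotient is 0 by convention.\<close>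
      then show ?thesis using binom_coeff_nonpos[of b k] False b
        by (intro divide_nonpos_nonpos) (auto simp: \<beta>_def)
    qed
    \<comment> \<open>The terms in \<open>min s t powr S\<close> have nonpositive coefficients for
      \<open>k \<ge> 1\<close>, so they are collected first; only their total is known to be
      nonnegative.\<close>
    have "positive_definite_on {0..} (\<lambda>s t. (\<Sum>k<K. binom_coeff b k / \<beta> k * G k s t)
       + 2 / S * (\<Sum>k<K. binom_coeff b k) * min s t powr S)"
      using S sum_binom_coeff_nonneg[OF b(2), of K]
      by (intro positive_definite_on_add positive_definite_on_sum positive_definite_on_scale
          positive_definite_on_min_powr coeff G) auto
    then show ?thesis
      by (rule positive_definite_on_cong)
         (simp only: term_eq atLeast_iff sum.distrib sum_distrib_left sum_distrib_right)
  qed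
qed

section \<open>Finiteness of the integral\<close>

text \<open>The base lies between 1/2 and 1, so raising the exponent to \<open>\<bar>q\<bar>\<close>
  and then lowering the base to 1/2 only decreases the power.\<close>

lemma one_minus_powr_lower_bound:
  fixes u q :: real
  assumes "0 \<le> u" "u \<le> 1/2"
  shows "2 powr - \<bar>q\<bar> \<le> (1 - u) powr q"
proof -
  have "2 powr - \<bar>q\<bar> = (1/2) powr \<bar>q\<bar>" by (simp add: powr_minus powr_divide inverse_eq_divide)
  also have "\<dots> \<le> (1 - u) powr \<bar>q\<bar>" using assms by (intro powr_mono2) auto
  also have "\<dots> \<le> (1 - u) powr q" using assms by (intro powr_mono') auto
  finally show ?thesis .
qed

text \<open>For the forward direction the point \<open>s = t = 1\<close> suffices: near 0 the second
  factor is bounded below, which forces \<open>a > -1\<close>, and the reflection \<open>u\<close>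
  to \<open>1 - u\<close> exchanges the exponents and gives \<open>b > -1\<close>.\<close>

lemma Q_finite_valued_iff: "Q_finite_valued a b \<longleftrightarrow> a > -1 \<and> b > -1"
proof
  assume "Q_finite_valued a b"
  then have "set_integrable lborel {0<..<1} (Q_integrand a b 1 1)"
    unfolding Q_finite_valued_def by (metis min.idem zero_le_one)
  then have *: "set_integrable lborel {0<..<1} (\<lambda>u. 2 * (u powr a * (1 - u) powr b))"
    by (simp add: Q_integrand_def[abs_def] mult_ac)
  then have int: "set_integrable lborel {0<..<1} (\<lambda>u. u powr a * (1 - u) powr b)"
    using set_integrable_mult_right[of "1/2", OF *] by simp
  have main: "p > -1" if "set_integrable lborel {0<..<1} (\<lambda>u::real. u powr p * (1 - u) powr q)" for p q :: real
  proof (rule powr_integrable_imp_gt)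
    have "set_integrable lborel {0<..<1/2} (\<lambda>u::real. u powr p * (1 - u) powr q)"
      by (rule set_integrable_subset[OF that]) auto
    then have 1: "set_integrable lborel {0<..<1/2} (\<lambda>u::real. 2 powr \<bar>q\<bar> * (u powr p * (1 - u) powr q))"
      by (intro set_integrable_mult_right)
    show "set_integrable lborel {0<..<1/2} (\<lambda>u::real. u powr p)"
    proof (rule set_integrable_bound[OF 1])
      show "set_borel_measurable lborel {0<..<1/2} (\<lambda>u::real. u powr p)"
        unfolding set_borel_measurable_def by measurable
      have "u powr p \<le> 2 powr \<bar>q\<bar> * (u powr p * (1 - u) powr q)" if u: "0 < u" "u < 1/2" for u :: real
      proof -
        have "2 powr \<bar>q\<bar> * 2 powr - \<bar>q\<bar> \<le> 2 powr \<bar>q\<bar> * (1 - u) powr q"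
          using u by (intro mult_left_mono one_minus_powr_lower_bound) auto
        then have "1 \<le> 2 powr \<bar>q\<bar> * (1 - u) powr q" by (simp flip: powr_add)
        then have "u powr p * 1 \<le> u powr p * (2 powr \<bar>q\<bar> * (1 - u) powr q)"
          by (intro mult_left_mono) auto
        then show ?thesis by (simp add: mult_ac)
      qed
      then show "AE u in lborel. u \<in> {0<..<1/2} \<longrightarrow> norm (u powr p) \<le> norm (2 powr \<bar>q\<bar> * (u powr p * (1 - u) powr q))"
        by (auto simp: abs_mult)
    qed
  qed simp
  have "set_integrable lborel {0<..<1} (\<lambda>u. u powr b * (1 - u) powr a)"
    using int reflect_set_integrable[of 1 "\<lambda>u. u powr b * (1 - u) powr a"] by (simp add: mult.commute)
  then show "a > -1 \<and> b > -1" using main int by blast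
next
  assume "a > -1 \<and> b > -1"
  then show "Q_finite_valued a b" unfolding Q_finite_valued_def
    by (auto intro: set_integrable_Q_integrand)
qed


section \<open>Inequalities implied by positive definiteness\<close>

lemma positive_definite_on_Cauchy_Schwarz:
  assumes pd: "positive_definite_on T K" and xy: "x \<in> T" "y \<in> T" and pos: "K y y > 0"
  shows "(K x y)\<^sup>2 \<le> K x x * K y y"
proof -
  \<comment> \<open>The coefficients \<open>K y y\<close> and \<open>- K x y\<close> describe, up to
    scaling, the residual of x after projection onto y.\<close>
  have "0 \<le> (\<Sum>i=1..2. \<Sum>j=1..2. (if i = 1 then K y y else - K x y) * (if j = 1 then K y y else - K x y) *
      K (if i = (1::nat) then x else y) (if j = (1::nat) then x else y))"
    by (rule positive_definite_on_nonneg[OF pd]) (use xy in auto)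
  also have "\<dots> = K y y * (K x x * K y y - (K x y)\<^sup>2)"
    using positive_definite_on_sym[OF pd xy]
    by (simp add: numeral_2_eq_2 power2_eq_square algebra_simps)
  finally show ?thesis using pos by (simp add: zero_le_mult_iff)
qed

text \<open>\<open>D s t\<close> is the variance of an increment. The coefficients 1, -2, 1 give the
  variance of a second difference, which is the right side minus the left side.\<close>

lemma positive_definite_on_parallelogram:
  assumes pd: "positive_definite_on T K" and "x \<in> T" "y \<in> T" "z \<in> T"
  defines "D \<equiv> \<lambda>s t. K s s + K t t - 2 * K s t"
  shows "D x z \<le> 2 * D x y + 2 * D y z"
proof -
  define t where "t i = (if i = 1 then x else if i = 2 then y else z)" for i :: nat
  define c where "c i = (if i = 2 then -2 else 1 :: real)" for i :: nat
  have "0 \<le> (\<Sum>i=1..3. \<Sum>j=1..3. c i * c j * K (t i) (t j))"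
    by (rule positive_definite_on_nonneg[OF pd]) (use assms in \<open>auto simp: t_def\<close>)
  also have "\<dots> = 2 * D x y + 2 * D y z - D x z"
    using positive_definite_on_sym[OF pd, of x y] positive_definite_on_sym[OF pd, of y z]
      positive_definite_on_sym[OF pd, of x z] assms(2-4)
    by (simp add: numeral_eq_Suc t_def c_def D_def algebra_simps)
  finally show ?thesis by simp
qed

lemma powr_bounded_near_0_imp_nonneg:
  fixes q C :: real
  assumes "\<And>s. 0 < s \<Longrightarrow> s \<le> 1/2 \<Longrightarrow> s powr q \<le> C"
  shows "q \<ge> 0"
proof (rule ccontr)
  assume q: "\<not> q \<ge> 0"
  \<comment> \<open>A value above \<open>C\<close> and at least \<open>(1/2) powr q\<close>, so that
    its preimage \<open>y powr (1/q)\<close> lies in the permitted range up to 1/2.\<close>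
  define y where "y = max (C + 1) ((1/2) powr q)"
  have y: "y > C" "y \<ge> (1/2) powr q" "y > 0"
    by (auto simp: y_def less_max_iff_disj)
  have "y powr (1/q) \<le> ((1/2) powr q) powr (1/q)"
    using y q by (intro powr_mono2') auto
  then have "y powr (1/q) \<le> 1/2" using q by (simp add: powr_powr)
  moreover have "(y powr (1/q)) powr q = y" using q y by (simp add: powr_powr)
  ultimately show False using assms[of "y powr (1/q)"] y by simp
qed

section \<open>Scaling and lower bounds of the incomplete beta integral\<close>

text \<open>Substitution \<open>u = s * x\<close>. This gives Q on the diagonal up to the constant
  \<open>incomplete_beta a b 1 1\<close>.\<close>

lemma incomplete_beta_scale:
  assumes "s > 0"
  shows "incomplete_beta a b s s = s powr (a + b + 1) * incomplete_beta a b 1 1"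
proof -
  have "incomplete_beta a b s s =
     s * (\<integral>x. indicator {0<..<s} (0 + s * x) *\<^sub>R ((0 + s * x) powr a * (s - (0 + s * x)) powr b) \<partial>lborel)"
    unfolding incomplete_beta_def set_lebesgue_integral_def
    by (subst lborel_integral_real_affine[of s _ 0]) (use assms in auto)
  also have "(\<lambda>x. indicator {0<..<s} (0 + s * x) *\<^sub>R ((0 + s * x) powr a * (s - (0 + s * x)) powr b)) =
     (\<lambda>x. s powr (a + b) * (indicator {0<..<1} x *\<^sub>R (x powr a * (1 - x) powr b)))"
  proof
    fix x
    have "(s - s * x) powr b = s powr b * (1 - x) powr b"
      by (simp add: powr_mult[symmetric] algebra_simps)
    moreover have "s * x \<in> {0<..<s} \<longleftrightarrow> x \<in> {0<..<1}"
      using assms by (simp add: zero_less_mult_iff)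
    ultimately show "indicator {0<..<s} (0 + s * x) *\<^sub>R ((0 + s * x) powr a * (s - (0 + s * x)) powr b) =
      s powr (a + b) * (indicator {0<..<1} x *\<^sub>R (x powr a * (1 - x) powr b))"
      by (auto simp: indicator_def powr_mult powr_add)
  qed
  also have "s * (\<integral>x. s powr (a + b) * (indicator {0<..<1} x *\<^sub>R (x powr a * (1 - x) powr b)) \<partial>lborel)
     = s powr (a + b + 1) * incomplete_beta a b 1 1"
    unfolding incomplete_beta_def set_lebesgue_integral_def
    using assms by (simp add: powr_add)
  finally show ?thesis .
qed

lemma incomplete_beta_nonneg: "incomplete_beta a b t x \<ge> 0"
  unfolding incomplete_beta_def set_lebesgue_integral_def by (rule Bochner_Integration.integral_nonneg) auto

lemma incomplete_beta_mono:
  assumes "a > -1" "b > -1" "x \<le> y" "y \<le> t"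
  shows "incomplete_beta a b t x \<le> incomplete_beta a b t y"
  unfolding incomplete_beta_def set_lebesgue_integral_def
  by (rule integral_mono; (unfold set_integrable_def[symmetric], rule beta_set_integrable)?)
     (use assms in \<open>auto simp: indicator_def\<close>)

lemma incomplete_beta_lower_bound:
  assumes "a > -1" "b > -1" "0 \<le> s" "s \<le> 1/2"
  shows "2 powr - \<bar>b\<bar> / (a + 1) * s powr (a + 1) \<le> incomplete_beta a b 1 s"
proof -
  have "2 powr - \<bar>b\<bar> / (a + 1) * s powr (a + 1) = (LBINT u:{0<..<s}. 2 powr - \<bar>b\<bar> * u powr a)"
    using powr_integral_from_0(2)[of a s] assms by simp
  also have "\<dots> \<le> incomplete_beta a b 1 s"
    unfolding incomplete_beta_def
  proof (rule set_integral_mono)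
    show "set_integrable lborel {0<..<s} (\<lambda>u. 2 powr - \<bar>b\<bar> * u powr a)"
      using powr_integral_from_0(1)[of a s] assms by (intro set_integrable_mult_right) auto
    show "set_integrable lborel {0<..<s} (\<lambda>u. u powr a * (1 - u) powr b)"
      by (rule beta_set_integrable) (use assms in auto)
    show "2 powr - \<bar>b\<bar> * u powr a \<le> u powr a * (1 - u) powr b" if "u \<in> {0<..<s}" for u
      using one_minus_powr_lower_bound[of u b] that assms
      by (subst mult.commute, intro mult_left_mono) auto
  qed
  finally show ?thesis .
qed

lemma incomplete_beta_pos:
  assumes "a > -1" "b > -1"
  shows "incomplete_beta a b 1 1 > 0"
proof -
  have "0 < 2 powr - \<bar>b\<bar> / (a + 1) * (1/2) powr (a + 1)" using assms by simp
  also have "\<dots> \<le> incomplete_beta a b 1 (1/2)"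
    using assms by (intro incomplete_beta_lower_bound) auto
  also have "\<dots> \<le> incomplete_beta a b 1 1" using assms by (intro incomplete_beta_mono) auto
  finally show ?thesis .
qed

section \<open>Necessity of the bound on \<open>\<bar>b\<bar>\<close>\<close>

lemma Q_positive_definite_imp_abs_le:
  assumes a: "a > -1" and b: "b > -1" and pd: "positive_definite_on {0..} (Q a b)"
  shows "\<bar>b\<bar> \<le> 1 + a"
proof -
  define B where "B = incomplete_beta a b 1 1"
  have B: "B > 0" using incomplete_beta_pos[OF a b] by (simp add: B_def)
  have diag: "Q a b s s = 2 * B * s powr (a + b + 1)" if "s > 0" for s
    using incomplete_beta_scale[OF that, of a b] by (simp add: Q_eq_incomplete_beta[OF a b] B_def)
  \<comment> \<open>Here \<open>y\<close> is any nonnegative lower bound of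
    \<open>Q a b s 1\<close>. It is used once for each of the two summands of
    \<open>Q a b s 1\<close>, each of which yields one of the two inequalities.\<close>
  have bound: "y\<^sup>2 \<le> 4 * B\<^sup>2 * s powr (a + b + 1)" if "0 < s" "s \<le> 1" "0 \<le> y" "y \<le> Q a b s 1" for s y
  proof -
    have "y\<^sup>2 \<le> (Q a b s 1)\<^sup>2" using that by (intro power_mono) auto
    also have "\<dots> \<le> Q a b s s * Q a b 1 1"
      using B that diag[of 1] by (intro positive_definite_on_Cauchy_Schwarz[OF pd]) auto
    finally show ?thesis using diag[of s] diag[of 1] that by (simp add: power2_eq_square mult_ac)
  qed
  have Q1: "Q a b s 1 = incomplete_beta a b 1 s + B * s powr (a + b + 1)" if "0 < s" "s \<le> 1" for s
    using that incomplete_beta_scale[of s a b] by (simp add: Q_eq_incomplete_beta[OF a b] B_def)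
  have "0 \<le> a + b + 1"
  proof (rule powr_bounded_near_0_imp_nonneg)
    fix s :: real assume s: "0 < s" "s \<le> 1/2"
    have "(B * s powr (a + b + 1))\<^sup>2 \<le> 4 * B\<^sup>2 * s powr (a + b + 1)"
      using s B incomplete_beta_nonneg[of a b 1 s] Q1[of s] by (intro bound) auto
    then have "B\<^sup>2 * s powr (a + b + 1) * s powr (a + b + 1) \<le> B\<^sup>2 * s powr (a + b + 1) * 4"
      by (simp add: power2_eq_square mult_ac)
    moreover have "B\<^sup>2 * s powr (a + b + 1) > 0" using B s by simp
    ultimately show "s powr (a + b + 1) \<le> 4" using mult_le_cancel_left_pos by blast
  qed
  moreover have "0 \<le> a + 1 - b"
  proof (rule powr_bounded_near_0_imp_nonneg)
    define c where "c = 2 powr - \<bar>b\<bar> / (a + 1)"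
    have c: "c > 0" using a by (simp add: c_def)
    fix s :: real assume s: "0 < s" "s \<le> 1/2"
    have "c * s powr (a + 1) \<le> Q a b s 1"
      using incomplete_beta_lower_bound[OF a b, of s] s B Q1[of s] by (simp add: c_def add_increasing2)
    then have "(c * s powr (a + 1))\<^sup>2 \<le> 4 * B\<^sup>2 * s powr (a + b + 1)"
      using s c by (intro bound) auto
    \<comment> \<open>The exponent \<open>2 * (a + 1)\<close> is split as
      \<open>(a + b + 1) + (a + 1 - b)\<close>, so that the common power cancels and
      \<open>s powr (a + 1 - b)\<close> stays bounded near 0.\<close>
    also have "(c * s powr (a + 1))\<^sup>2 = c\<^sup>2 * s powr (a + b + 1) * s powr (a + 1 - b)"
      by (simp add: power_mult_distrib power2_eq_square powr_add[symmetric])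
    also have "4 * B\<^sup>2 * s powr (a + b + 1) = c\<^sup>2 * s powr (a + b + 1) * (4 * B\<^sup>2 / c\<^sup>2)"
      using c by simp
    finally show "s powr (a + 1 - b) \<le> 4 * B\<^sup>2 / c\<^sup>2"
      by (rule mult_left_le_imp_le) (use c s in simp)
  qed
  ultimately show ?thesis by auto
qed

section \<open>Necessity of \<open>b \<le> 1\<close> through the variance of increments\<close>

text \<open>What remains is the integral over \<open>{t-h<..<t}\<close>; reflecting it by
  \<open>u\<close> to \<open>t - u\<close> exchanges the two exponents.\<close>

lemma incomplete_beta_diff:
  assumes "a > -1" "b > -1" "0 \<le> h" "h \<le> t"
  shows "incomplete_beta a b t t - incomplete_beta a b t (t - h) = incomplete_beta b a t h"
proof -
  let ?f = "\<lambda>u. u powr a * (t - u) powr b"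
  have int: "set_integrable lborel {0<..<t} ?f" using assms by (intro beta_set_integrable) auto
  have sub: "set_integrable lborel A ?f" if "A \<subseteq> {0<..<t}" "A \<in> sets lborel" for A
    using that by (intro set_integrable_subset[OF int]) auto
  have "incomplete_beta a b t t = (LBINT u:{0<..<t-h} \<union> {t-h<..<t}. ?f u)"
    unfolding incomplete_beta_def
    by (rule set_integral_discrete_difference[of "{0, t-h}"]) (use assms in auto)
  also have "\<dots> = incomplete_beta a b t (t - h) + (LBINT u:{t-h<..<t}. ?f u)"
    unfolding incomplete_beta_def
    by (rule set_integral_Un; (intro sub)?) (use assms in auto)
  also have "(LBINT u:{t-h<..<t}. ?f u) = 
      (\<integral>u. indicator {t-h<..<t} (t + (-1) * u) *\<^sub>R ?f (t + (-1) * u) \<partial>lborel)"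
    unfolding set_lebesgue_integral_def by (subst lborel_integral_real_affine[of "-1" _ t]) auto
  also have "\<dots> = incomplete_beta b a t h"
    unfolding incomplete_beta_def set_lebesgue_integral_def
    by (intro Bochner_Integration.integral_cong) (auto simp: indicator_def)
  finally show ?thesis by simp
qed

text \<open>For \<open>u < h\<close> the base \<open>t - u\<close> lies between 1 and
  \<open>T\<close>, so its power is between \<open>T powr - \<bar>q\<bar>\<close> and
  \<open>T powr \<bar>q\<bar>\<close> for either sign of \<open>q\<close>; integrating
  \<open>u powr p\<close> gives the rest.\<close>

lemma incomplete_beta_bounds:
  assumes p: "p > -1" and h: "0 < h" "h + 1 \<le> t" "t \<le> T"
  shows "T powr - \<bar>q\<bar> * (h powr (p + 1) / (p + 1)) \<le> incomplete_beta p q t h"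
    and "incomplete_beta p q t h \<le> T powr \<bar>q\<bar> * (h powr (p + 1) / (p + 1))"
proof -
  have const: "set_integrable lborel {0<..<h} (\<lambda>u. c * u powr p)"
    "c * (h powr (p + 1) / (p + 1)) = (LBINT u:{0<..<h}. c * u powr p)" for c
    using powr_integral_from_0[OF p, of h] h by auto
  have bd: "T powr - \<bar>q\<bar> \<le> (t - u) powr q" "(t - u) powr q \<le> T powr \<bar>q\<bar>" if "u \<in> {0<..<h}" for u
  proof -
    have r: "1 \<le> t - u" "t - u \<le> T" using that h by auto
    have "T powr - \<bar>q\<bar> \<le> (t - u) powr - \<bar>q\<bar>" using r by (intro powr_mono2') auto
    also have "\<dots> \<le> (t - u) powr q" using r by (intro powr_mono) auto
    finally show "T powr - \<bar>q\<bar> \<le> (t - u) powr q" .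
    have "(t - u) powr q \<le> (t - u) powr \<bar>q\<bar>" using r by (intro powr_mono) auto
    also have "\<dots> \<le> T powr \<bar>q\<bar>" using r by (intro powr_mono2) auto
    finally show "(t - u) powr q \<le> T powr \<bar>q\<bar>" .
  qed
  have int: "set_integrable lborel {0<..<h} (\<lambda>u. u powr p * (t - u) powr q)"
  proof (rule set_integrable_bound[OF const(1)])
    show "set_borel_measurable lborel {0<..<h} (\<lambda>u. u powr p * (t - u) powr q)"
      unfolding set_borel_measurable_def by measurable
    show "AE u in lborel. u \<in> {0<..<h} \<longrightarrow> norm (u powr p * (t - u) powr q) \<le> norm (T powr \<bar>q\<bar> * u powr p)"
      using bd(2) by (auto simp: abs_mult mult.commute[of _ "_ powr p"] intro!: mult_left_mono)
  qed
  show "T powr - \<bar>q\<bar> * (h powr (p + 1) / (p + 1)) \<le> incomplete_beta p q t h"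
    unfolding const(2) incomplete_beta_def using bd(1)
    by (intro set_integral_mono const int) (subst mult.commute, intro mult_left_mono, auto)
  show "incomplete_beta p q t h \<le> T powr \<bar>q\<bar> * (h powr (p + 1) / (p + 1))"
    unfolding const(2) incomplete_beta_def using bd(2)
    by (intro set_integral_mono const int) (subst (2) mult.commute, intro mult_left_mono, auto)
qed

lemma Q_positive_definite_imp_le_1:
  assumes a: "a > -1" and b: "b > -1" and pd: "positive_definite_on {0..} (Q a b)"
  shows "b \<le> 1"
proof -
  have le: "2 powr (b + 1) \<le> 4 * (1 + 2 * h) powr (2 * \<bar>a\<bar>)" if h: "h > 0" for h
  proof -
    define D where "D s t = Q a b s s + Q a b t t - 2 * Q a b s t" for s t
    \<comment> \<open>The terms \<open>incomplete_beta a b s s\<close> cancel in \<open>D\<close>,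
      leaving twice the difference treated in \<open>incomplete_beta_diff\<close>.\<close>
    have D: "D s t = 2 * incomplete_beta b a t (t - s)" if "0 < s" "s \<le> t" for s t
      using incomplete_beta_diff[OF a b, of "t - s" t] that
      by (simp add: D_def Q_eq_incomplete_beta[OF a b])
    \<comment> \<open>For the points \<open>1\<close>, \<open>1 + h\<close>,
      \<open>1 + 2 * h\<close>, all away from the singularity at 0, \<open>H\<close> is the main
      term of a step \<open>h\<close>, and \<open>E\<close> is an error factor that tends to 1 with
      \<open>h\<close>.\<close>
    define E where "E = (1 + 2 * h) powr \<bar>a\<bar>"
    define H where "H = h powr (b + 1) / (b + 1)"
    have pos: "E > 0" "H > 0" using h b by (auto simp: E_def H_def)
    have "inverse E * (2 powr (b + 1) * H) = (1 + 2 * h) powr - \<bar>a\<bar> * ((2 * h) powr (b + 1) / (b + 1))"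
      by (simp add: E_def H_def powr_minus powr_mult)
    also have "\<dots> \<le> incomplete_beta b a (1 + 2 * h) (2 * h)"
      using h b by (intro incomplete_beta_bounds) auto
    also have "\<dots> \<le> 2 * incomplete_beta b a (1 + h) h + 2 * incomplete_beta b a (1 + 2 * h) h"
      using positive_definite_on_parallelogram[OF pd, of 1 "1 + h" "1 + 2 * h"] h
        D[of 1 "1 + h"] D[of "1 + h" "1 + 2 * h"] D[of 1 "1 + 2 * h"]
      by (simp flip: D_def)
    also have "\<dots> \<le> 2 * (E * H) + 2 * (E * H)"
      using incomplete_beta_bounds(2)[OF b, of h "1 + h" "1 + 2 * h" a]
        incomplete_beta_bounds(2)[OF b, of h "1 + 2 * h" "1 + 2 * h" a] h
      by (simp flip: E_def H_def)
    finally have "2 powr (b + 1) * H \<le> 4 * (E * E) * H"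
      using pos by (simp add: field_simps)
    then have "2 powr (b + 1) \<le> 4 * (E * E)" using pos by simp
    also have "E * E = (1 + 2 * h) powr (2 * \<bar>a\<bar>)" by (simp add: E_def powr_add[symmetric])
    finally show ?thesis .
  qed
  \<comment> \<open>Letting \<open>h\<close> tend to 0 removes the error factor and leaves
    \<open>2 powr (b + 1) \<le> 4\<close>.\<close>
  have "((\<lambda>h::real. 4 * (1 + 2 * h) powr (2 * \<bar>a\<bar>)) \<longlongrightarrow> 4 * (1 + 2 * 0) powr (2 * \<bar>a\<bar>)) (at_right 0)"
    by (intro tendsto_intros) auto
  then have "2 powr (b + 1) \<le> 4 * (1 + 2 * 0 :: real) powr (2 * \<bar>a\<bar>)"
    by (rule tendsto_lowerbound)
       (auto simp: le eventually_at_right_less intro: eventually_mono[OF eventually_at_right_less])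
  also have "\<dots> = 2 powr (2::real)" by simp
  finally show ?thesis by (subst (asm) powr_le_cancel_iff) auto
qed

theorem theorem2p1:
  fixes a b :: real
  shows "(Q_finite_valued a b \<and> positive_definite_on {0..} (Q a b)) \<longleftrightarrow>
         (a > -1 \<and> -1 < b \<and> b \<le> 1 \<and> \<bar>b\<bar> \<le> 1 + a)"
  using Q_finite_valued_iff Q_positive_definite_imp_abs_le Q_positive_definite_imp_le_1
    Q_positive_definite by blast

end
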